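(* Let $r>1$ and $t>2r+1$. Let $g:\mathbb{R}\to\mathbb{C}$ be a $1$-periodic function of class $C^{t}$ with Fourier expansion $g(x)=\sum_{k=-\infty}^{\infty} c_k e^{2\pi i kx}$, and assume that $c_k\neq 0$ for every $k\in\mathbb{Z}$. Let $\alpha$ be a real number that is Diophantine of type $r$. Then the power series $$ f_{g,\alpha}(z)=\sum_{n=0}^{\infty} g(n\alpha)\, z^n , \qquad |z|<1, $$ cannot be analytically continued beyond the unit circle.
   Context: A real number $\alpha$ is Diophantine of type $r$ (where $r>1$) if there exists $C>0$ such that $|\alpha-\frac{p}{q}|\ge \frac{C}{q^{1+r}}$ for all rational numbers $p/q$ (with $q\geq 1$). For integer $t$, $C^t$ means $t$ times continuously differentiable; for non-integer $t$ it is the usual Hölder class. "Cannot be analytically continued beyond the unit circle" means that the unit circle is a natural boundary: for no point $z_0$ with $|z_0|=1$ do there exist an open disc $U$ centered at $z_0$ and a holomorphic function on $U$ which agrees with $f_{g,\alpha}$ on $U\cap\{|z|<1\}$. *)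

theory Defs
  imports "HOL-Analysis.Analysis"
begin

definition diophantine_of_type :: "real \<Rightarrow> real \<Rightarrow> bool" where
  "diophantine_of_type r \<alpha> \<longleftrightarrow>
     (\<exists>C>0. \<forall>p::int. \<forall>q::nat. q \<ge> 1 \<longrightarrow>
        \<bar>\<alpha> - of_int p / of_nat q\<bar> \<ge> C / real q powr (1 + r))"

definition vderiv :: "(real \<Rightarrow> complex) \<Rightarrow> real \<Rightarrow> complex" where
  "vderiv f = (\<lambda>x. vector_derivative f (at x))"

definition times_cont_differentiable :: "nat \<Rightarrow> (real \<Rightarrow> complex) \<Rightarrow> bool" where
  "times_cont_differentiable m f \<longleftrightarrow>
     (\<forall>j<m. \<forall>x. (vderiv ^^ j) f differentiable (at x)) \<and>
     continuous_on UNIV ((vderiv ^^ m) f)"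

(* The class C^t for real t \<ge> 0. For non-integer t the Hoelder condition on the
   derivative of order floor t is imposed globally on the real line; for periodic
   functions this is the same as the local condition. *)
definition C_class :: "real \<Rightarrow> (real \<Rightarrow> complex) \<Rightarrow> bool" where
  "C_class t f \<longleftrightarrow>
     times_cont_differentiable (nat \<lfloor>t\<rfloor>) f \<and>
     (t \<notin> \<int> \<longrightarrow>
       (\<exists>M. \<forall>x y. norm ((vderiv ^^ nat \<lfloor>t\<rfloor>) f x - (vderiv ^^ nat \<lfloor>t\<rfloor>) f y)
                 \<le> M * \<bar>x - y\<bar> powr frac t))"

definition fourier_coeff :: "(real \<Rightarrow> complex) \<Rightarrow> int \<Rightarrow> complex" where
  "fourier_coeff g k =
     integral {0..1} (\<lambda>x. g x * exp (- 2 * of_real pi * \<i> * of_int k * of_real x))"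

(* Only meaningful where the series converges; for bounded g this includes the
   open unit disc, the only place where it is used. *)
definition rotation_series :: "(real \<Rightarrow> complex) \<Rightarrow> real \<Rightarrow> complex \<Rightarrow> complex" where
  "rotation_series g \<alpha> z = (\<Sum>n. g (of_nat n * \<alpha>) * z ^ n)"

definition unit_circle_natural_boundary :: "(complex \<Rightarrow> complex) \<Rightarrow> bool" where
  "unit_circle_natural_boundary f \<longleftrightarrow>
     (\<forall>z0. norm z0 = 1 \<longrightarrow>
        \<not> (\<exists>e>0. \<exists>h. h holomorphic_on ball z0 e \<and>
                     (\<forall>z \<in> ball z0 e \<inter> ball 0 1. h z = f z)))"

end

theory Submission
  imports Defs
begin

text \<open>For irrational \<open>\<alpha>\<close>, Weyl's equidistribution argument with Abel means in place of Cesaro means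
  shows that \<open>(1 - \<rho>) f(\<rho> w)\<close> tends to \<open>c\<^sub>k\<close> as \<open>\<rho>\<close> increases to \<open>1\<close>, where \<open>w = e\<^sup>-\<^sup>2\<^sup>\<pi>\<^sup>i\<^sup>k\<^sup>\<alpha>\<close>. If
  \<open>c\<^sub>k \<noteq> 0\<close>, then \<open>f\<close> is unbounded along the radius to \<open>w\<close>, and these points are dense in the circle.\<close>

section \<open>Trigonometric polynomials of period 1\<close>

text \<open>Generation by single characters and sums gives an induction rule suited to claims that
  are additive in the function, such as convergence of Abel means. Closure under products is then a
  lemma rather than a rule.\<close>

inductive trig_poly :: "(real \<Rightarrow> complex) \<Rightarrow> bool" where
  monom: "trig_poly (\<lambda>x. c * cis (2 * pi * (of_int k * x)))"
| add: "trig_poly p \<Longrightarrow> trig_poly q \<Longrightarrow> trig_poly (\<lambda>x. p x + q x)"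

lemma trig_poly_const: "trig_poly (\<lambda>x. c)"
  using trig_poly.monom[of c 0] by simp

lemma trig_poly_monom_mult:
  assumes "trig_poly p"
  shows "trig_poly (\<lambda>x. c * cis (2 * pi * (of_int k * x)) * p x)"
  using assms
proof induction
  case (monom d l)
  have "c * cis (2 * pi * (of_int k * x)) * (d * cis (2 * pi * (of_int l * x)))
      = (c * d) * cis (2 * pi * (of_int (k + l) * x))" for x
    by (simp add: cis_mult[symmetric] distrib_left distrib_right)
  then show ?case
    using trig_poly.monom[of "c * d" "k + l"] by presburger
next
  case (add p q)
  then show ?case
    using trig_poly.add[OF add.IH] by (simp add: distrib_left)
qed

text \<open>Induction on the first factor; its monomial case is an induction on the second factor,
  where frequencies add. Products are needed because polynomial functions are closed under
  them.\<close>

lemma trig_poly_mult: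
  assumes "trig_poly p" "trig_poly q"
  shows "trig_poly (\<lambda>x. p x * q x)"
  using assms
proof induction
  case (monom c k)
  then show ?case by (rule trig_poly_monom_mult)
next
  case (add p p')
  then show ?case
    using trig_poly.add[of "\<lambda>x. p x * q x" "\<lambda>x. p' x * q x"] by (simp add: distrib_right)
qed

lemma trig_poly_cos: "trig_poly (\<lambda>x. of_real (cos (2 * pi * x)))"
proof -
  have "of_real (cos (2 * pi * x)) = 1 / 2 * cis (2 * pi * (of_int 1 * x)) + 1 / 2 * cis (2 * pi * (of_int (-1) * x))" for x
    by (simp add: complex_eq_iff)
  then show ?thesis
    using trig_poly.add[OF trig_poly.monom[of "1/2" 1] trig_poly.monom[of "1/2" "-1"]] by presburger
qed

lemma trig_poly_sin: "trig_poly (\<lambda>x. of_real (sin (2 * pi * x)))"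
proof -
  have "of_real (sin (2 * pi * x)) = - \<i> / 2 * cis (2 * pi * (of_int 1 * x)) + \<i> / 2 * cis (2 * pi * (of_int (-1) * x))" for x
    by (simp add: complex_eq_iff)
  then show ?thesis
    using trig_poly.add[OF trig_poly.monom[of "-\<i>/2" 1] trig_poly.monom[of "\<i>/2" "-1"]] by presburger
qed

text \<open>Here the complex numbers are the real plane, so these are polynomials in
  \<open>Re z\<close> and \<open>Im z\<close>, not just in \<open>z\<close>. A real-linear form
  restricts to a combination of cosine and sine on the circle, and the other generators match the
  closure properties above.\<close>

lemma trig_poly_real_polynomial_function:
  fixes p :: "complex \<Rightarrow> real"
  assumes "real_polynomial_function p"
  shows "trig_poly (\<lambda>x. of_real (p (cis (2 * pi * x))))"
  using assms
proof induction
  case (linear f)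
  interpret bounded_linear f by fact
  have "f (cis y) = f 1 * cos y + f \<i> * sin y" for y
  proof -
    have "cis y = cos y *\<^sub>R 1 + sin y *\<^sub>R \<i>"
      by (simp add: complex_eq_iff)
    then show ?thesis
      by (metis add scaleR mult.commute real_scaleR_def)
  qed
  then show ?case
    using trig_poly.add[OF trig_poly_mult[OF trig_poly_const[of "of_real (f 1)"] trig_poly_cos]
        trig_poly_mult[OF trig_poly_const[of "of_real (f \<i>)"] trig_poly_sin]]
    by simp
next
  case (const c)
  then show ?case by (rule trig_poly_const)
next
  case (add f g)
  then show ?case using trig_poly.add by simp
next
  case (mult f g)
  then show ?case using trig_poly_mult by simp
qed

lemma trig_poly_polynomial_function:
  fixes p :: "complex \<Rightarrow> complex"
  assumes "polynomial_function p"
  shows "trig_poly (\<lambda>x. p (cis (2 * pi * x)))"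
proof -
  have "trig_poly (\<lambda>x. of_real (Re (p (cis (2 * pi * x)))))"
    and "trig_poly (\<lambda>x. of_real (Im (p (cis (2 * pi * x)))))"
    using assms trig_poly_real_polynomial_function[of "Re \<circ> p"]
      trig_poly_real_polynomial_function[of "Im \<circ> p"]
    by (auto simp: polynomial_function_def bounded_linear_Re bounded_linear_Im)
  from trig_poly.add[OF this(1) trig_poly_mult[OF trig_poly_const[of \<i>] this(2)]]
  show ?thesis
    by (simp add: complex_eq[symmetric])
qed

section \<open>Periodic functions as functions on the circle, and uniform approximation\<close>

lemma periodic_int:
  fixes G :: "real \<Rightarrow> 'a"
  assumes per: "\<And>x. G (x + 1) = G x"
  shows "G (x + of_int m) = G x"
proof (induction m arbitrary: x rule: int_induct[where k = 0])
  case (step1 i)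
  then show ?case using per[of "x + of_int i"] by (simp add: algebra_simps)
next
  case (step2 i)
  then show ?case using per[of "x + of_int i - 1"] by (simp add: algebra_simps)
qed simp

text \<open>Equal points on the circle have angles differing by whole turns. Hence a periodic
  function descends to the circle, whichever branch of the argument is used.\<close>

lemma periodic_cis_eq:
  fixes G :: "real \<Rightarrow> 'a"
  assumes per: "\<And>x. G (x + 1) = G x" and "cis (2 * pi * x) = cis (2 * pi * y)"
  shows "G x = G y"
proof -
  obtain n :: int where "2 * pi * x = 2 * pi * y + 2 * of_int n * pi"
    using arg_cong[OF assms(2), of Re] arg_cong[OF assms(2), of Im]
      sin_cos_eq_iff[of "2 * pi * x" "2 * pi * y"] by auto
  then have "2 * pi * x = 2 * pi * (y + of_int n)"
    by (simp add: algebra_simps)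
  then have "x = y + of_int n"
    by simp
  then show ?thesis using periodic_int[of G, OF per] by simp
qed

text \<open>The two branches \<open>Arg\<close> and \<open>Arg2pi\<close> have disjoint cuts and define the same function.\<close>

lemma periodic_lift:
  fixes G :: "real \<Rightarrow> complex"
  assumes per: "\<And>x. G (x + 1) = G x" and cont: "continuous_on UNIV G"
  obtains F where "continuous_on (sphere 0 1) F" "\<And>x. F (cis (2 * pi * x)) = G x"
proof
  define F where "F z = G (Arg z / (2 * pi))" for z
  have F2: "F z = G (Arg2pi z / (2 * pi))" if "z \<noteq> 0" for z
  proof -
    have "of_real (cmod z) * cis (Arg z) = of_real (cmod z) * cis (Arg2pi z)"
      using Arg_eq[OF that] Arg2pi_eq[of z] by (simp add: cis_conv_exp)
    then show ?thesis
      unfolding F_def using that by (intro periodic_cis_eq[of G, OF per]) simp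
  qed
  show "F (cis (2 * pi * x)) = G x" for x
    unfolding F_def by (rule periodic_cis_eq[of G, OF per]) (simp add: cis_Arg)
  have G: "isCont G x" for x
    using cont by (simp add: continuous_on_eq_continuous_at)
  have "isCont F z" if "z \<noteq> 0" for z
  proof (cases "z \<in> \<real>\<^sub>\<le>\<^sub>0")
    case False
    then have "isCont (\<lambda>z. Arg z / (2 * pi)) z"
      by (intro continuous_intros continuous_at_Arg) auto
    then show ?thesis
      unfolding F_def by (rule isCont_o2) (rule G)
  next
    case True
    with that have "z \<notin> \<real>\<^sub>\<ge>\<^sub>0"
      by (auto simp: complex_nonneg_Reals_iff complex_nonpos_Reals_iff complex_eq_iff)
    then have "isCont (\<lambda>z. Arg2pi z / (2 * pi)) z"
      by (intro continuous_intros continuous_at_Arg2pi) auto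
    then have "isCont (\<lambda>z. G (Arg2pi z / (2 * pi))) z"
      by (rule isCont_o2) (rule G)
    \<comment> \<open>Both branches give the same function on the whole punctured plane, an open
      neighbourhood of \<open>z\<close>, so continuity carries over to \<open>F\<close>.\<close>
    moreover have "eventually (\<lambda>z. F z = G (Arg2pi z / (2 * pi))) (nhds z)"
      using that F2 by (auto intro!: eventually_mono[OF eventually_nhds_in_open[of "- {0}" z]])
    ultimately show ?thesis
      by (simp add: isCont_cong)
  qed
  then show "continuous_on (sphere 0 1) F"
    by (intro continuous_at_imp_continuous_on) (metis dist_0_norm mem_sphere norm_zero zero_neq_one)
qed

text \<open>Transport to the unit circle, which is compact, makes Stone-Weierstrass applicable;
  polynomials in the plane pull back to trigonometric polynomials.\<close>

lemma trig_poly_dense: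
  fixes G :: "real \<Rightarrow> complex"
  assumes per: "\<And>x. G (x + 1) = G x" and cont: "continuous_on UNIV G" and "\<epsilon> > 0"
  obtains p where "trig_poly p" "\<And>x. norm (G x - p x) < \<epsilon>"
proof -
  obtain F where F: "continuous_on (sphere 0 1) F" "\<And>x. F (cis (2 * pi * x)) = G x"
    using periodic_lift[of G, OF per cont] by blast
  obtain p where "polynomial_function p" "\<And>z. z \<in> sphere 0 1 \<Longrightarrow> norm (F z - p z) < \<epsilon>"
    using Stone_Weierstrass_polynomial_function[OF _ F(1) \<open>\<epsilon> > 0\<close>] by auto
  then show ?thesis
    using that[of "\<lambda>x. p (cis (2 * pi * x))"] trig_poly_polynomial_function F(2) 
    by (metis dist_0_norm mem_sphere norm_cis)
qed

lemma trig_poly_continuous: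
  assumes "trig_poly p"
  shows "continuous_on UNIV p"
  using assms by induction (auto intro!: continuous_intros)

lemma trig_poly_bounded:
  assumes "trig_poly p"
  obtains B where "\<And>x. norm (p x) \<le> B"
proof -
  from assms have "\<exists>B. \<forall>x. norm (p x) \<le> B"
  proof induction
    case (monom c k)
    then show ?case by (auto simp: norm_mult)
  next
    case (add p q)
    then show ?case by (meson norm_triangle_mono)
  qed
  then show ?thesis using that by blast
qed

section \<open>Abel means along the orbit of the rotation\<close>

lemma summable_rotation_series:
  fixes z :: complex
  assumes "\<And>x. norm (G x) \<le> B" "norm z < 1"
  shows "summable (\<lambda>n. G (of_nat n * \<alpha>) * z ^ n)"
proof (rule summable_comparison_test')
  show "summable (\<lambda>n. B * norm z ^ n)"
    using assms by (intro summable_mult summable_geometric) simp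
  show "norm (G (of_nat n * \<alpha>) * z ^ n) \<le> B * norm z ^ n" if "n \<ge> 0" for n
    using assms by (simp add: norm_mult norm_power mult_right_mono)
qed

text \<open>The factor \<open>1 - \<rho>\<close> cancels the geometric sum exactly. The bound is
  thus uniform in \<open>\<rho>\<close>, so a uniform approximation of the function costs no more in
  its Abel means.\<close>

lemma norm_rotation_series_le:
  assumes "\<And>x. norm (G x) \<le> B" "0 \<le> \<rho>" "\<rho> < 1"
  shows "norm ((1 - of_real \<rho>) * rotation_series G \<alpha> (of_real \<rho>)) \<le> B"
proof -
  have "norm (rotation_series G \<alpha> (of_real \<rho>)) \<le> (\<Sum>n. B * \<rho> ^ n)"
    unfolding rotation_series_def
    using assms by (intro norm_suminf_le) 
      (auto simp: norm_mult norm_power intro!: mult_right_mono summable_mult summable_geometric)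
  also have "\<dots> = B / (1 - \<rho>)"
    using assms by (simp add: suminf_mult summable_geometric suminf_geometric)
  finally have "(1 - \<rho>) * norm (rotation_series G \<alpha> (of_real \<rho>)) \<le> (1 - \<rho>) * (B / (1 - \<rho>))"
    using assms by (intro mult_left_mono) auto
  moreover have "norm (1 - of_real \<rho> :: complex) = 1 - \<rho>"
    using assms by (metis abs_of_pos diff_gt_0_iff_gt norm_of_real of_real_1 of_real_diff)
  ultimately show ?thesis
    using assms by (simp add: norm_mult)
qed

lemma integral_cis_int:
  assumes "k \<noteq> 0"
  shows "integral {0..1} (\<lambda>x. cis (2 * pi * (of_int k * x))) = 0"
proof -
  have "integral {0..1} (\<lambda>x. exp ((2 * of_real pi * \<i> * of_int k) * of_real x)) = 0"
    using assms exp_integer_2pi[of "of_int k"]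
    by (subst integral_exp) (auto simp: mult_ac)
  then show ?thesis
    by (simp add: cis_conv_exp mult_ac)
qed

text \<open>This keeps the denominator \<open>1 - w * \<rho>\<close> of the geometric sum for a
  nonconstant character away from zero as \<open>\<rho>\<close> tends to 1.\<close>

lemma cis_irrational_neq_1:
  assumes "\<alpha> \<notin> \<rat>" "k \<noteq> 0"
  shows "cis (2 * pi * (of_int k * \<alpha>)) \<noteq> 1"
proof
  assume "cis (2 * pi * (of_int k * \<alpha>)) = 1"
  then have "cos (2 * pi * (of_int k * \<alpha>)) = 1"
    by (simp add: complex_eq_iff)
  then obtain n :: int where "2 * pi * (of_int k * \<alpha>) = of_int n * 2 * pi"
    using cos_one_2pi_int by blast
  then have "\<alpha> = of_int n / of_int k"
    using assms by (simp add: field_simps)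
  then show False
    using assms by simp
qed

lemma eventually_at_left_1: "\<forall>\<^sub>F \<rho> in at_left (1::real). 0 < \<rho> \<and> \<rho> < 1"
  using eventually_at_left_real[of 0 "1::real"] by simp

text \<open>A single character yields a geometric series with ratio \<open>w * \<rho>\<close>. For
  frequency 0 the mean is constantly \<open>c\<close>; otherwise the sum stays finite at
  \<open>\<rho> = 1\<close> and the factor \<open>1 - \<rho>\<close> sends the mean to 0, which is
  the integral of the character.\<close>

lemma abel_mean_trig_poly:
  assumes "\<alpha> \<notin> \<rat>" "trig_poly p"
  shows "((\<lambda>\<rho>. (1 - of_real \<rho>) * rotation_series p \<alpha> (of_real \<rho>)) \<longlongrightarrow> integral {0..1} p) (at_left 1)"
  using assms(2)
proof induction
  case (monom c k)
  define w where "w = cis (2 * pi * (of_int k * \<alpha>))"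
  have eq: "rotation_series (\<lambda>x. c * cis (2 * pi * (of_int k * x))) \<alpha> (of_real \<rho>)
          = c / (1 - w * of_real \<rho>)" if "0 < \<rho> \<and> \<rho> < 1" for \<rho>
  proof -
    have "c * cis (2 * pi * (of_int k * (of_nat n * \<alpha>))) * of_real \<rho> ^ n = c * (w * of_real \<rho>) ^ n" for n
      unfolding w_def by (simp add: power_mult_distrib Complex.DeMoivre mult_ac)
    moreover have "norm (w * of_real \<rho>) < 1"
      using that by (simp add: w_def norm_mult)
    ultimately show ?thesis
      unfolding rotation_series_def
      by (simp only: suminf_mult summable_geometric suminf_geometric) simp
  qed
  show ?case
  proof (cases "k = 0")
    case True
    have "\<forall>\<^sub>F \<rho> in at_left 1. (1 - of_real \<rho>) * rotation_series (\<lambda>x. c * cis (2 * pi * (of_int k * x))) \<alpha> (of_real \<rho>) = c"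
      using eventually_at_left_1
    proof eventually_elim
      case (elim \<rho>)
      then have "of_real \<rho> \<noteq> (1::complex)" by simp
      then show ?case
        using eq[OF elim] True by (simp add: w_def)
    qed
    then show ?thesis
      using True by (simp add: tendsto_eventually)
  next
    case False
    have "w \<noteq> 1"
      unfolding w_def using cis_irrational_neq_1[OF assms(1) False] .
    then have "((\<lambda>\<rho>. (1 - of_real \<rho>) * (c / (1 - w * of_real \<rho>))) \<longlongrightarrow> (1 - of_real 1) * (c / (1 - w * of_real 1))) (at_left 1)"
      by (intro tendsto_intros) auto
    moreover have "\<forall>\<^sub>F \<rho> in at_left 1. (1 - of_real \<rho>) * (c / (1 - w * of_real \<rho>))
        = (1 - of_real \<rho>) * rotation_series (\<lambda>x. c * cis (2 * pi * (of_int k * x))) \<alpha> (of_real \<rho>)"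
      using eventually_at_left_1 by eventually_elim (simp add: eq)
    ultimately show ?thesis
      using integral_cis_int[OF False] by (simp add: tendsto_cong)
  qed
next
  case (add p q)
  \<comment> \<open>Boundedness provides the convergence needed to add the two series
    termwise.\<close>
  obtain B C where B: "\<And>x. norm (p x) \<le> B" and C: "\<And>x. norm (q x) \<le> C"
    using add.hyps trig_poly_bounded by metis
  have "\<forall>\<^sub>F \<rho> in at_left 1. (1 - of_real \<rho>) * rotation_series p \<alpha> (of_real \<rho>) + (1 - of_real \<rho>) * rotation_series q \<alpha> (of_real \<rho>)
     = (1 - of_real \<rho>) * rotation_series (\<lambda>x. p x + q x) \<alpha> (of_real \<rho>)"
    using eventually_at_left_1
  proof eventually_elim
    case (elim \<rho>)
    then show ?case
      unfolding rotation_series_def distrib_right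
      by (subst suminf_add[symmetric])
        (auto intro!: summable_rotation_series B C simp: distrib_left)
  qed
  moreover have "integral {0..1} (\<lambda>x. p x + q x) = integral {0..1} p + integral {0..1} q"
    using add.hyps by (intro integral_add integrable_continuous_real)
      (auto intro: continuous_on_subset trig_poly_continuous)
  ultimately show ?case
    using tendsto_add[OF add.IH] by (simp add: tendsto_cong)
qed

text \<open>Uniform approximation by a trigonometric polynomial: one third of
  \<open>\<epsilon>\<close> each for the change of the Abel mean, the change of the integral, and
  the convergence for the polynomial.\<close>

lemma abel_mean_periodic:
  fixes G :: "real \<Rightarrow> complex"
  assumes "\<alpha> \<notin> \<rat>" and per: "\<And>x. G (x + 1) = G x" and cont: "continuous_on UNIV G"
  shows "((\<lambda>\<rho>. (1 - of_real \<rho>) * rotation_series G \<alpha> (of_real \<rho>)) \<longlongrightarrow> integral {0..1} G) (at_left 1)"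
proof (rule tendstoI)
  fix \<epsilon> :: real assume "\<epsilon> > 0"
  then have "\<epsilon> / 3 > 0"
    by simp
  then obtain p where p: "trig_poly p" and near: "\<And>x. norm (G x - p x) < \<epsilon> / 3"
    using trig_poly_dense[of G, OF per cont] by blast
  obtain B where B: "\<And>x. norm (p x) \<le> B"
    using trig_poly_bounded[OF p] by blast
  \<comment> \<open>A bound for \<open>G\<close> comes from its approximant; it makes the series of
    \<open>G\<close> summable, so the difference of the two series can be taken termwise.\<close>
  have BG: "norm (G x) \<le> B + \<epsilon> / 3" for x
    using norm_triangle_ineq[of "p x" "G x - p x"] B[of x] near[of x] by simp
  have cont01: "continuous_on {0..1} G" "continuous_on {0..1} p"
    using cont trig_poly_continuous[OF p] by (auto intro: continuous_on_subset)
  then have int: "G integrable_on {0..1}" "p integrable_on {0..1}"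
    by (auto intro: integrable_continuous_real)
  have "norm (integral {0..1} (\<lambda>x. G x - p x)) \<le> \<epsilon> / 3 * (1 - 0)"
    using near cont01
    by (intro integral_bound continuous_on_diff) (auto intro: less_imp_le)
  then have I: "norm (integral {0..1} G - integral {0..1} p) \<le> \<epsilon> / 3"
    using integral_diff[OF int] by simp
  have "\<forall>\<^sub>F \<rho> in at_left 1. dist ((1 - of_real \<rho>) * rotation_series p \<alpha> (of_real \<rho>)) (integral {0..1} p) < \<epsilon> / 3"
    using abel_mean_trig_poly[OF assms(1) p] \<open>\<epsilon> / 3 > 0\<close> by (rule tendstoD)
  then show "\<forall>\<^sub>F \<rho> in at_left 1. dist ((1 - of_real \<rho>) * rotation_series G \<alpha> (of_real \<rho>)) (integral {0..1} G) < \<epsilon>"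
    using eventually_at_left_1
  proof eventually_elim
    case (elim \<rho>)
    let ?M = "\<lambda>G. (1 - of_real \<rho>) * rotation_series G \<alpha> (of_real \<rho>)"
    have "rotation_series G \<alpha> (of_real \<rho>) - rotation_series p \<alpha> (of_real \<rho>)
        = rotation_series (\<lambda>x. G x - p x) \<alpha> (of_real \<rho>)"
      unfolding rotation_series_def left_diff_distrib
      using elim by (intro suminf_diff summable_rotation_series[OF B] summable_rotation_series[OF BG]) auto
    then have "?M (\<lambda>x. G x - p x) = ?M G - ?M p"
      by (simp only: right_diff_distrib[symmetric])
    then have "norm (?M G - ?M p) \<le> \<epsilon> / 3"
      using norm_rotation_series_le[of "\<lambda>x. G x - p x" "\<epsilon> / 3" \<rho> \<alpha>] near elim
      by (simp add: less_imp_le)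
    then have "dist (?M G) (?M p) \<le> \<epsilon> / 3"
      by (simp only: dist_norm)
    moreover have "dist (integral {0..1} p) (integral {0..1} G) \<le> \<epsilon> / 3"
      using I by (simp add: dist_norm norm_minus_commute)
    ultimately show ?case
      using elim dist_triangle[of "?M G" "integral {0..1} G" "?M p"]
        dist_triangle[of "?M p" "integral {0..1} G" "integral {0..1} p"] by linarith
  qed
qed

section \<open>Radial limits and density of the singular directions\<close>

text \<open>Turning the radius by the angle of \<open>w\<close> amounts to multiplying
  \<open>g\<close> by a character of frequency \<open>-k\<close>. The product is again periodic and
  continuous, and its mean is the Fourier coefficient of index \<open>k\<close>.\<close>

lemma radial_limit_rotation_series:
  fixes g :: "real \<Rightarrow> complex"
  assumes "\<alpha> \<notin> \<rat>" and per: "\<And>x. g (x + 1) = g x" and cont: "continuous_on UNIV g"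
  shows "((\<lambda>\<rho>. (1 - of_real \<rho>) * rotation_series g \<alpha> (of_real \<rho> * cis (- (2 * pi * (of_int k * \<alpha>)))))
            \<longlongrightarrow> fourier_coeff g k) (at_left 1)"
proof -
  define G where "G x = g x * cis (- (2 * pi * (of_int k * x)))" for x
  have "G (x + 1) = G x" for x
  proof -
    have "cis (- (2 * pi * (of_int k * (x + 1)))) = cis (- (2 * pi * (of_int k * x))) * cis (2 * pi * of_int (- k))"
      unfolding cis_mult by (simp add: algebra_simps)
    also have "cis (2 * pi * of_int (- k)) = 1"
      by (rule cis_multiple_2pi) simp
    finally show ?thesis by (simp add: G_def per)
  qed
  moreover have "continuous_on UNIV G"
    unfolding G_def by (intro continuous_intros cont)
  ultimately have "((\<lambda>\<rho>. (1 - of_real \<rho>) * rotation_series G \<alpha> (of_real \<rho>)) \<longlongrightarrow> integral {0..1} G) (at_left 1)"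
    by (intro abel_mean_periodic assms)
  moreover have "integral {0..1} G = fourier_coeff g k"
    unfolding fourier_coeff_def G_def by (simp add: cis_conv_exp mult_ac)
  moreover have "rotation_series G \<alpha> (of_real \<rho>)
      = rotation_series g \<alpha> (of_real \<rho> * cis (- (2 * pi * (of_int k * \<alpha>))))" for \<rho>
    unfolding rotation_series_def G_def power_mult_distrib Complex.DeMoivre
    by (simp add: mult_ac)
  ultimately show ?thesis by simp
qed

text \<open>Multiples of an irrational number are dense modulo 1, and \<open>cis\<close> is
  continuous and ignores whole turns.\<close>

lemma cis_multiples_dense:
  assumes "\<alpha> \<notin> \<rat>" "norm z = 1" "e > 0"
  obtains k :: int where "cis (- (2 * pi * (of_int k * \<alpha>))) \<in> ball z e"
proof -
  \<comment> \<open>The angle of \<open>z\<close> in turns, negated to match the sign in the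
    exponent of \<open>w\<close>.\<close>
  define \<beta> where "\<beta> = - (Arg z / (2 * pi))"
  have "z \<noteq> 0"
    using assms(2) by auto
  then have z: "z = cis (- (2 * pi * \<beta>))"
    using Arg_eq[of z] assms(2) by (auto simp: \<beta>_def cis_conv_exp)
  have "isCont (\<lambda>x. cis (- (2 * pi * x))) \<beta>"
    unfolding cis_conv_exp by (intro continuous_intros)
  then obtain d where d: "d > 0" "\<And>x. dist x \<beta> < d \<Longrightarrow> dist (cis (- (2 * pi * x))) z < e"
    using \<open>e > 0\<close> unfolding continuous_at_eps_delta z dist_norm real_norm_def by metis
  obtain h k where "\<bar>of_int k * \<alpha> - of_int h - \<beta>\<bar> < d"
    using sequence_of_fractional_parts_is_dense[OF assms(1) d(1)] by metis
  then have "dist (cis (- (2 * pi * (of_int k * \<alpha> - of_int h)))) z < e"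
    by (intro d) (simp add: dist_real_def)
  moreover have "cis (- (2 * pi * (of_int k * \<alpha> - of_int h)))
      = cis (- (2 * pi * (of_int k * \<alpha>))) * cis (2 * pi * of_int h)"
    unfolding cis_mult by (simp add: algebra_simps)
  moreover have "cis (2 * pi * of_int h) = 1"
    by (rule cis_multiple_2pi) simp
  ultimately show ?thesis
    using that[of k] by (simp add: dist_commute)
qed

section \<open>Arithmetic and regularity of the data, and the natural boundary\<close>

text \<open>A rational number is at distance 0 from its own fraction, against a strictly positive
  lower bound.\<close>

lemma diophantine_of_type_irrational:
  assumes "diophantine_of_type r \<alpha>"
  shows "\<alpha> \<notin> \<rat>"
proof
  assume "\<alpha> \<in> \<rat>"
  then obtain p q :: int where pq: "q > 0" "\<alpha> = of_int p / of_int q"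
    by (meson Rats_cases')
  obtain C where "C > 0" and C: "\<And>p::int. \<And>q::nat. q \<ge> 1 \<Longrightarrow>
      C / real q powr (1 + r) \<le> \<bar>\<alpha> - of_int p / of_nat q\<bar>"
    using assms unfolding diophantine_of_type_def by auto
  have "C / real (nat q) powr (1 + r) \<le> 0"
    using C[of "nat q" p] pq by simp
  moreover have "C / real (nat q) powr (1 + r) > 0"
    using \<open>C > 0\<close> pq by simp
  ultimately show False by simp
qed

lemma C_class_continuous:
  assumes "C_class t g" "t \<ge> 1"
  shows "continuous_on UNIV g"
proof -
  \<comment> \<open>Order 0 is then among the derivatives required to be differentiable, and this is
    \<open>g\<close> itself.\<close>
  have "0 < nat \<lfloor>t\<rfloor>"
    using assms(2) by simp
  then have "\<forall>x. (vderiv ^^ 0) g differentiable (at x)"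
    using assms(1) unfolding C_class_def times_cont_differentiable_def by blast
  then show ?thesis
    by (auto intro!: continuous_at_imp_continuous_on differentiable_imp_continuous_within)
qed

theorem proposition2:
  fixes r t \<alpha> :: real and g :: "real \<Rightarrow> complex"
  assumes "r > 1"
    and "t > 2 * r + 1"
    and "\<forall>x. g (x + 1) = g x"
    and "C_class t g"
    and "\<forall>k::int. fourier_coeff g k \<noteq> 0"
    and "diophantine_of_type r \<alpha>"
  shows "unit_circle_natural_boundary (rotation_series g \<alpha>)"
  unfolding unit_circle_natural_boundary_def
proof (intro allI impI notI, elim exE conjE)
  fix z0 e h
  assume "norm (z0::complex) = 1" "e > 0" and hol: "h holomorphic_on ball z0 e"
    and h: "\<forall>z\<in>ball z0 e \<inter> ball 0 1. h z = rotation_series g \<alpha> z"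
  have irr: "\<alpha> \<notin> \<rat>"
    using assms(6) by (rule diophantine_of_type_irrational)
  obtain k :: int where k: "cis (- (2 * pi * (of_int k * \<alpha>))) \<in> ball z0 e"
    using cis_multiples_dense[OF irr \<open>norm z0 = 1\<close> \<open>e > 0\<close>] .
  define w where "w = cis (- (2 * pi * (of_int k * \<alpha>)))"
  have w: "w \<in> ball z0 e"
    using k by (simp add: w_def)
  have path: "((\<lambda>\<rho>. of_real \<rho> * w) \<longlongrightarrow> w) (at_left 1)"
    by (auto intro!: tendsto_eq_intros)
  have "isCont h w"
    using hol w holomorphic_on_imp_continuous_on continuous_on_eq_continuous_at open_ball by blast
  then have "((\<lambda>\<rho>. h (of_real \<rho> * w)) \<longlongrightarrow> h w) (at_left 1)"
    using path by (rule isCont_tendsto_compose)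
  \<comment> \<open>A continuation has a finite value at \<open>w\<close>, so the factor
    \<open>1 - \<rho>\<close> forces the limit 0.\<close>
  then have "((\<lambda>\<rho>. (1 - of_real \<rho>) * h (of_real \<rho> * w)) \<longlongrightarrow> (1 - of_real 1) * h w) (at_left 1)"
    by (intro tendsto_intros)
  \<comment> \<open>Near its end the radius lies in both the disc around \<open>z0\<close> and the
    open unit disc, where \<open>h\<close> and the series agree.\<close>
  moreover have "\<forall>\<^sub>F \<rho> in at_left 1. of_real \<rho> * w \<in> ball z0 e"
    using path w by (intro topological_tendstoD) auto
  then have "\<forall>\<^sub>F \<rho> in at_left 1. (1 - of_real \<rho>) * h (of_real \<rho> * w)
      = (1 - of_real \<rho>) * rotation_series g \<alpha> (of_real \<rho> * w)"
    using eventually_at_left_1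
  proof eventually_elim
    case (elim \<rho>)
    then have "of_real \<rho> * w \<in> ball z0 e \<inter> ball 0 1"
      by (simp add: w_def norm_mult)
    then show ?case using h by simp
  qed
  ultimately have "((\<lambda>\<rho>. (1 - of_real \<rho>) * rotation_series g \<alpha> (of_real \<rho> * w)) \<longlongrightarrow> 0) (at_left 1)"
    by (simp add: tendsto_cong)
  moreover have "continuous_on UNIV g"
    using assms by (intro C_class_continuous[of t]) auto
  then have "((\<lambda>\<rho>. (1 - of_real \<rho>) * rotation_series g \<alpha> (of_real \<rho> * w)) \<longlongrightarrow> fourier_coeff g k) (at_left 1)"
    unfolding w_def using irr assms(3) by (intro radial_limit_rotation_series) auto
  \<comment> \<open>The same radial expression has limits 0 and the Fourier coefficient, so these
    coincide.\<close>
  ultimately have "fourier_coeff g k = 0"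
    using tendsto_unique[OF trivial_limit_at_left_real] by blast
  then show False
    using assms(5) by simp
qed

end
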